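(* Let $G=(V,E)$ be a connected graph and let $\widehat G=(V,E\cup F)$ with $F\subseteq\binom{V}{2}\setminus E$. For $e=st\in E\cup F$, the inequality $x_e\le 1$ defines a facet of $\mathrm{LMC}(G,\widehat G)$ if and only if there is no $uv\in F\setminus\{e\}$ such that both $s$ and $t$ are $uv$-cut-nodes with respect to $G$.
   Context: Graphs are finite, simple, undirected; $uv$ denotes $\{u,v\}$. For nodes $u,v$, a node $w\in V$ is a $uv$-cut-node (with respect to $G$) if every $uv$-path in $G$ contains $w$. A decomposition of $G$ is a partition $\Pi$ of $V$ such that each block induces a connected subgraph of $G$; the multicut of $\widehat G$ lifted from $G$ induced by $\Pi$ is the set of edges of $E\cup F$ whose endpoints lie in distinct blocks of $\Pi$. $\mathrm{LMC}(G,\widehat G)\subseteq\mathbb{R}^{E\cup F}$ is the convex hull of the characteristic vectors of all multicuts of $\widehat G$ lifted from $G$. *)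

theory Defs
  imports "HOL-Analysis.Analysis" "HOL-Library.Ramsey"
begin

definition graph_path :: "'v set \<Rightarrow> 'v set set \<Rightarrow> 'v \<Rightarrow> 'v \<Rightarrow> 'v list \<Rightarrow> bool" where
  "graph_path V E u v p \<longleftrightarrow>
     p \<noteq> [] \<and> hd p = u \<and> last p = v \<and> set p \<subseteq> V \<and> distinct p \<and>
     successively (\<lambda>x y. {x, y} \<in> E) p"

definition graph_connected :: "'v set \<Rightarrow> 'v set set \<Rightarrow> bool" where
  "graph_connected V E \<longleftrightarrow> V \<noteq> {} \<and> (\<forall>u\<in>V. \<forall>v\<in>V. \<exists>p. graph_path V E u v p)"

definition induced_edges :: "'v set set \<Rightarrow> 'v set \<Rightarrow> 'v set set" where
  "induced_edges E U = {e \<in> E. e \<subseteq> U}"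

definition cut_node :: "'v set \<Rightarrow> 'v set set \<Rightarrow> 'v \<Rightarrow> 'v \<Rightarrow> 'v \<Rightarrow> bool" where
  "cut_node V E u v w \<longleftrightarrow> w \<in> V \<and> (\<forall>p. graph_path V E u v p \<longrightarrow> w \<in> set p)"

definition decomposition :: "'v set \<Rightarrow> 'v set set \<Rightarrow> 'v set set \<Rightarrow> bool" where
  "decomposition V E P \<longleftrightarrow>
     partition_on V P \<and> (\<forall>U\<in>P. graph_connected U (induced_edges E U))"

definition lifted_multicut :: "'v set set \<Rightarrow> 'v set set \<Rightarrow> 'v set set \<Rightarrow> 'v set set" where
  "lifted_multicut E F P =
     {e \<in> E \<union> F. \<exists>u v. e = {u, v} \<and> (\<exists>A\<in>P. \<exists>B\<in>P. A \<noteq> B \<and> u \<in> A \<and> v \<in> B)}"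

definition char_vec :: "'i set \<Rightarrow> real ^ 'i::finite" where
  "char_vec S = (\<chi> i. if i \<in> S then 1 else 0)"

text \<open>The space of real vectors indexed by \<open>E \<union> F\<close> is represented by the coordinate subspace
  of vectors indexed by all vertex sets that vanish outside \<open>E \<union> F\<close>.  Faces and affine
  dimension are unaffected by this embedding.\<close>

definition LMC :: "'v::finite set \<Rightarrow> 'v set set \<Rightarrow> 'v set set \<Rightarrow> (real ^ 'v set) set" where
  "LMC V E F = convex hull {char_vec (lifted_multicut E F P) |P. decomposition V E P}"

definition defines_facet ::
    "('a::euclidean_space \<Rightarrow> real) \<Rightarrow> real \<Rightarrow> 'a set \<Rightarrow> bool" where
  "defines_facet c b P \<longleftrightarrow> (\<forall>x\<in>P. c x \<le> b) \<and> {x \<in> P. c x = b} facet_of P"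

end

theory Submission
  imports Defs
begin

text \<open>If every \<open>uv\<close>-path meets both \<open>s\<close> and \<open>t\<close>, then separating \<open>s\<close> from \<open>t\<close> separates \<open>u\<close> from
  \<open>v\<close>, so the face \<open>x\<^sub>s\<^sub>t = 1\<close> lies in the proper face \<open>x\<^sub>u\<^sub>v = 1\<close>; the inclusion is strict because
  the part of a \<open>uv\<close>-path between \<open>s\<close> and \<open>t\<close> is a block joining \<open>s\<close> and \<open>t\<close> but not \<open>u\<close> and \<open>v\<close>.

  Conversely, let \<open>p\<close> be a \<open>uv\<close>-path that avoids \<open>s\<close> or \<open>t\<close>. Contracting \<open>p\<close> to a single block changes
  the all-ones vector exactly in the coordinates of the edges inside \<open>p\<close>. Apart from \<open>uv\<close>, these join
  the ends of proper subpaths of \<open>p\<close>, so by induction on the length of \<open>p\<close> the unit vector of \<open>uv\<close>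
  lies in the span of the face. Hence the face spans the whole coordinate space.\<close>

section \<open>Paths, subpaths and connectivity\<close>

lemma graph_path_rev:
  assumes "graph_path V E u v p"
  shows "graph_path V E v u (rev p)"
  using assms unfolding graph_path_def
  by (simp add: hd_rev last_rev insert_commute)

lemma graph_path_mono:
  assumes "graph_path U D u v p" "U \<subseteq> V" "D \<subseteq> E"
  shows "graph_path V E u v p"
  using assms unfolding graph_path_def
  by (auto elim!: successively_mono)

lemma graph_path_ends:
  assumes "graph_path V E u v p"
  shows "u \<in> set p" "v \<in> set p"
  using assms unfolding graph_path_def by auto

lemma graph_path_induced:
  assumes "graph_path V E u v p"
  shows "graph_path (set p) (induced_edges E (set p)) u v p"
proof -
  have "successively (\<lambda>x y. {x, y} \<in> E) p"
    using assms by (simp add: graph_path_def)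
  then have "successively (\<lambda>x y. {x, y} \<in> induced_edges E (set p)) p"
    by (subst successively_cong[where Q = "\<lambda>x y. {x, y} \<in> E"]) (auto simp: induced_edges_def)
  with assms show ?thesis by (simp add: graph_path_def)
qed

text \<open>The entries of a path are distinct, so its first node lies in an infix only if nothing
  precedes the infix, and its last node only if nothing follows. Thus only the whole path contains
  both ends.\<close>

lemma graph_path_infix:
  assumes "graph_path V E u v (as @ x # bs @ y # cs)"
  shows "graph_path V E x y (x # bs @ [y])"
    and "{u, v} \<subseteq> set (x # bs @ [y]) \<Longrightarrow> u = x \<and> v = y"
proof -
  show "graph_path V E x y (x # bs @ [y])"
    using assms unfolding graph_path_def
    by (auto simp: successively_append_iff successively_Cons hd_append split: if_splits)
next
  assume uv: "{u, v} \<subseteq> set (x # bs @ [y])"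
  have p: "hd (as @ x # bs @ y # cs) = u" "last (as @ x # bs @ y # cs) = v"
    "distinct (as @ x # bs @ y # cs)"
    using assms by (auto simp: graph_path_def)
  have "as = []"
    using p(1,3) uv by (cases as) auto
  moreover have "cs = []"
    using p(2,3) uv by (cases cs rule: rev_cases) auto
  ultimately show "u = x \<and> v = y" using p(1,2) by simp
qed

text \<open>If \<open>y\<close> precedes \<open>x\<close> on \<open>p\<close>, the infix is
  reversed; hence the last property compares unordered pairs. It makes the subpath proper for every
  pair other than the ends of \<open>p\<close>.\<close>

lemma graph_subpath:
  assumes p: "graph_path V E u v p" and "x \<in> set p" "y \<in> set p" "x \<noteq> y"
  obtains q where "graph_path V E x y q" "set q \<subseteq> set p"
    "{u, v} \<subseteq> set q \<Longrightarrow> {u, v} = {x, y}"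
proof -
  have "(\<exists>as bs cs. p = as @ x # bs @ y # cs) \<or> (\<exists>as bs cs. p = as @ y # bs @ x # cs)"
  proof -
    obtain as bs where 1: "p = as @ x # bs" using \<open>x \<in> set p\<close> by (meson split_list)
    then consider "y \<in> set as" | "y \<in> set bs" using assms by auto
    then show ?thesis
    proof cases
      case 1
      then obtain cs ds where "as = cs @ y # ds" by (meson split_list)
      with \<open>p = as @ x # bs\<close> have "p = cs @ y # ds @ x # bs" by simp
      then show ?thesis by blast
    next
      case 2
      then show ?thesis using \<open>p = as @ x # bs\<close> by (metis split_list)
    qed
  qed
  then consider as bs cs where "p = as @ x # bs @ y # cs"
    | as bs cs where "p = as @ y # bs @ x # cs" by blast
  then show thesis
  proof cases
    case 1
    note inf = graph_path_infix[OF p[unfolded 1]]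
    show thesis
    proof (rule that[OF inf(1)])
      show "set (x # bs @ [y]) \<subseteq> set p" unfolding 1 by auto
      show "{u, v} = {x, y}" if "{u, v} \<subseteq> set (x # bs @ [y])"
        using inf(2)[OF that] by simp
    qed
  next
    case 2
    note inf = graph_path_infix[OF p[unfolded 2]]
    show thesis
    proof (rule that[OF graph_path_rev[OF inf(1)]])
      show "set (rev (y # bs @ [x])) \<subseteq> set p" unfolding 2 by auto
      show "{u, v} = {x, y}" if "{u, v} \<subseteq> set (rev (y # bs @ [x]))"
        using inf(2) that by (simp only: set_rev) blast
    qed
  qed
qed

lemma graph_connected_path:
  assumes "graph_path V E u v p"
  shows "graph_connected (set p) (induced_edges E (set p))"
  unfolding graph_connected_def
proof (intro conjI ballI)
  show "set p \<noteq> {}" using assms by (simp add: graph_path_def)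
next
  fix x y assume xy: "x \<in> set p" "y \<in> set p"
  show "\<exists>q. graph_path (set p) (induced_edges E (set p)) x y q"
  proof (cases "x = y")
    case True
    then have "graph_path (set p) (induced_edges E (set p)) x y [x]"
      using xy by (simp add: graph_path_def)
    then show ?thesis ..
  next
    case False
    then show ?thesis
      using graph_subpath[OF graph_path_induced[OF assms] xy] by metis
  qed
qed

section \<open>Decompositions with at most one block that is not a singleton\<close>

definition single_block :: "'v set \<Rightarrow> 'v set \<Rightarrow> 'v set set" where
  "single_block V U = insert U ((\<lambda>v. {v}) ` (V - U))"

lemma decomposition_single_block:
  assumes "U \<subseteq> V" and U: "graph_connected U (induced_edges E U)"
  shows "decomposition V E (single_block V U)"
proof -
  have "graph_connected {w} D" for w :: 'a and D
    unfolding graph_connected_def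
    by (auto intro!: exI[of _ "[w]"] simp: graph_path_def)
  moreover have "U \<noteq> {}" using U by (simp add: graph_connected_def)
  ultimately show ?thesis using assms
    by (auto simp: decomposition_def single_block_def partition_on_def disjoint_def)
qed

lemma lifted_multicut_single_block:
  assumes "E \<union> F \<subseteq> nsets V 2" "U \<subseteq> V"
  shows "lifted_multicut E F (single_block V U) = {g \<in> E \<union> F. \<not> g \<subseteq> U}"
proof (intro set_eqI iffI)
  fix g assume "g \<in> lifted_multicut E F (single_block V U)"
  then show "g \<in> {g \<in> E \<union> F. \<not> g \<subseteq> U}"
    unfolding lifted_multicut_def single_block_def by auto
next
  fix g assume g: "g \<in> {g \<in> E \<union> F. \<not> g \<subseteq> U}"
  with assms have "g \<in> nsets V 2" by blast
  then obtain a b where ab: "g = {a, b}" "a \<noteq> b" "a \<in> V" "b \<in> V"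
    by (auto simp: nsets_def card_2_iff)
  \<comment> \<open>For \<open>w \<in> V\<close> this is the block containing \<open>w\<close>. If
    \<open>a\<close> and \<open>b\<close> had the same block, then either \<open>a = b\<close> or
    both would lie in \<open>U\<close>.\<close>
  define B where "B w = (if w \<in> U then U else {w})" for w
  have B: "w \<in> B w" "w \<in> V \<Longrightarrow> B w \<in> single_block V U" for w
    by (auto simp: B_def single_block_def)
  have "B a \<noteq> B b" using g ab by (auto simp: B_def)
  then show "g \<in> lifted_multicut E F (single_block V U)"
    using g ab B unfolding lifted_multicut_def by blast
qed

section \<open>Separation of nodes and cut-nodes\<close>

lemma mem_lifted_multicut_iff:
  assumes "{a, b} \<in> E \<union> F"
  shows "{a, b} \<in> lifted_multicut E F P \<longleftrightarrow> (\<exists>A\<in>P. \<exists>B\<in>P. A \<noteq> B \<and> a \<in> A \<and> b \<in> B)"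
proof
  assume "{a, b} \<in> lifted_multicut E F P"
  then obtain u v A B where
    *: "{a, b} = {u, v}" "A \<in> P" "B \<in> P" "A \<noteq> B" "u \<in> A" "v \<in> B"
    unfolding lifted_multicut_def by blast
  then consider "a = u" "b = v" | "a = v" "b = u" by (auto simp: doubleton_eq_iff)
  then show "\<exists>A\<in>P. \<exists>B\<in>P. A \<noteq> B \<and> a \<in> A \<and> b \<in> B"
    using * by cases blast+
next
  assume "\<exists>A\<in>P. \<exists>B\<in>P. A \<noteq> B \<and> a \<in> A \<and> b \<in> B"
  then show "{a, b} \<in> lifted_multicut E F P"
    using assms unfolding lifted_multicut_def by blast
qed

text \<open>By contraposition: a block containing \<open>u\<close> and \<open>v\<close> is
  connected, hence contains a \<open>uv\<close>-path of the whole graph. Both cut-nodes lie on this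
  path, so \<open>s\<close> and \<open>t\<close> share that block.\<close>

lemma separated_of_cut_nodes:
  assumes P: "decomposition V E P" and uv: "{u, v} \<subseteq> V" "{u, v} \<in> E \<union> F"
    and cut: "cut_node V E u v s" "cut_node V E u v t"
    and st: "{s, t} \<in> lifted_multicut E F P"
  shows "{u, v} \<in> lifted_multicut E F P"
proof (rule ccontr)
  assume nuv: "{u, v} \<notin> lifted_multicut E F P"
  have part: "partition_on V P" using P by (simp add: decomposition_def)
  obtain A B where AB: "A \<in> P" "B \<in> P" "u \<in> A" "v \<in> B"
    using part uv(1) by (auto simp: partition_on_def)
  then have "A = B" using nuv mem_lifted_multicut_iff[OF uv(2)] by blast
  moreover have "graph_connected A (induced_edges E A)"
    using P AB by (simp add: decomposition_def)
  ultimately obtain p where p: "graph_path A (induced_edges E A) u v p"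
    using AB by (auto simp: graph_connected_def)
  have "A \<subseteq> V" using part AB by (auto simp: partition_on_def)
  then have "graph_path V E u v p"
    by (rule graph_path_mono[OF p]) (auto simp: induced_edges_def)
  then have "s \<in> set p" "t \<in> set p" using cut by (auto simp: cut_node_def)
  then have "s \<in> A" "t \<in> A" using p by (auto simp: graph_path_def)
  moreover have "{s, t} \<in> E \<union> F" using st by (simp add: lifted_multicut_def)
  then obtain C D where CD: "C \<in> P" "D \<in> P" "C \<noteq> D" "s \<in> C" "t \<in> D"
    using st mem_lifted_multicut_iff by metis
  moreover have "C' = A" if "C' \<in> P" "w \<in> C'" "w \<in> A" for C' w
    using part that AB(1) by (auto simp: partition_on_def disjoint_def)
  ultimately show False by metis
qed

section \<open>The polytope and the faces where a coordinate is 1\<close>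

lemma char_vec_nth [simp]: "char_vec S $ i = (if i \<in> S then 1 else 0)"
  by (simp add: char_vec_def)

lemma char_vec_eq_sum: "char_vec S = (\<Sum>g\<in>S. axis g 1)"
  by (simp add: vec_eq_iff axis_def)

lemma convex_LMC: "convex (LMC V E F)"
  by (simp add: LMC_def)

lemma char_vec_in_LMC:
  "decomposition V E P \<Longrightarrow> char_vec (lifted_multicut E F P) \<in> LMC V E F"
  unfolding LMC_def by (rule hull_inc) blast

lemma LMC_subset:
  assumes "convex C" "\<And>P. decomposition V E P \<Longrightarrow> char_vec (lifted_multicut E F P) \<in> C"
  shows "LMC V E F \<subseteq> C"
  unfolding LMC_def using assms by (intro hull_minimal) auto

lemma LMC_le_1:
  assumes "x \<in> LMC V E F"
  shows "x $ g \<le> 1"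
proof -
  have "convex {x :: real ^ 'a set. axis g 1 \<bullet> x \<le> 1}" by (rule convex_halfspace_le)
  then have "LMC V E F \<subseteq> {x. axis g 1 \<bullet> x \<le> 1}"
    by (rule LMC_subset) (simp add: inner_axis')
  then show ?thesis using assms by (auto simp: inner_axis')
qed

lemma face_of_LMC: "{x \<in> LMC V E F. x $ g = 1} face_of LMC V E F"
proof -
  have "(LMC V E F \<inter> {x. axis g 1 \<bullet> x = 1}) face_of LMC V E F"
    by (rule face_of_Int_supporting_hyperplane_le[OF convex_LMC])
       (simp add: inner_axis' LMC_le_1)
  moreover have "LMC V E F \<inter> {x. axis g 1 \<bullet> x = 1} = {x \<in> LMC V E F. x $ g = 1}"
    by (auto simp: inner_axis')
  ultimately show ?thesis by simp
qed

text \<open>Connectedness of the graph makes \<open>V\<close> itself a block, which cuts nothing.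
  The origin shows that each face where a coordinate is 1 is proper.\<close>

lemma zero_in_LMC:
  assumes "E \<union> F \<subseteq> nsets V 2" "E \<subseteq> nsets V 2" "graph_connected V E"
  shows "0 \<in> LMC V E F"
proof -
  have "induced_edges E V = E"
    using assms(2) by (auto simp: induced_edges_def nsets_def)
  then have dec: "decomposition V E (single_block V V)"
    using assms(3) by (intro decomposition_single_block) auto
  have "lifted_multicut E F (single_block V V) = {}"
    using assms(1) by (auto simp: lifted_multicut_single_block nsets_def)
  then have "char_vec (lifted_multicut E F (single_block V V)) = 0"
    by (simp add: vec_eq_iff)
  with char_vec_in_LMC[OF dec, of F] show ?thesis by simp
qed

text \<open>Besides the origin, these are the only points of the polytope exhibited below. A path
  with one node yields the all-ones vector on \<open>E \<union> F\<close>.\<close>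

lemma path_block_in_LMC:
  assumes "E \<union> F \<subseteq> nsets V 2" "graph_path V E u v p"
  shows "char_vec {g \<in> E \<union> F. \<not> g \<subseteq> set p} \<in> LMC V E F"
proof -
  have "set p \<subseteq> V" using assms(2) by (simp add: graph_path_def)
  then show ?thesis
    using char_vec_in_LMC[OF decomposition_single_block[OF _ graph_connected_path[OF assms(2)]], of V F]
    by (simp add: lifted_multicut_single_block[OF assms(1)])
qed

section \<open>Cut-nodes prevent a facet\<close>

lemma not_facet_of_cut_nodes:
  fixes V :: "'v::finite set"
  assumes EF: "E \<union> F \<subseteq> nsets V 2" and E: "E \<subseteq> nsets V 2" and conn: "graph_connected V E"
    and st: "{s, t} \<in> E \<union> F" and uv: "{u, v} \<in> E \<union> F" "{u, v} \<noteq> {s, t}"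
    and cut: "cut_node V E u v s" "cut_node V E u v t"
  shows "\<not> {x \<in> LMC V E F. x $ {s, t} = 1} facet_of LMC V E F"
proof
  let ?P = "LMC V E F"
  let ?A = "{x \<in> ?P. x $ {s, t} = 1}" and ?B = "{x \<in> ?P. x $ {u, v} = 1}"
  assume facet: "?A facet_of ?P"
  have uvV: "{u, v} \<subseteq> V" using EF uv by (auto simp: nsets_def)
  have "s \<noteq> t" using EF st by (auto simp: nsets_def)
  \<comment> \<open>The half-space of \<open>x $ {s, t} \<le> x $ {u, v}\<close>; it suffices to
    check this inequality on the generating characteristic vectors.\<close>
  have "convex {x :: real ^ 'v set. (axis {s, t} 1 - axis {u, v} 1) \<bullet> x \<le> 0}"
    by (rule convex_halfspace_le)
  then have "?P \<subseteq> {x. (axis {s, t} 1 - axis {u, v} 1) \<bullet> x \<le> 0}"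
    by (rule LMC_subset)
       (use separated_of_cut_nodes[OF _ uvV uv(1) cut] in
         \<open>auto simp: inner_diff_left inner_axis'\<close>)
  then have le: "x $ {s, t} \<le> x $ {u, v}" if "x \<in> ?P" for x
    using that by (auto simp: inner_diff_left inner_axis')
  have sub: "?A \<subseteq> ?B" using le LMC_le_1 by (force intro: antisym)
  obtain p where p: "graph_path V E u v p"
    using conn uvV by (auto simp: graph_connected_def)
  then have "s \<in> set p" "t \<in> set p" using cut by (auto simp: cut_node_def)
  then obtain q where q: "graph_path V E s t q" "{u, v} \<subseteq> set q \<Longrightarrow> {u, v} = {s, t}"
    using graph_subpath[OF p _ _ \<open>s \<noteq> t\<close>] by metis
  \<comment> \<open>Contracting \<open>q\<close> joins \<open>s\<close> and \<open>t\<close>, while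
    \<open>q\<close> misses \<open>u\<close> or \<open>v\<close> because
    \<open>{u, v} \<noteq> {s, t}\<close>.\<close>
  have "char_vec {g \<in> E \<union> F. \<not> g \<subseteq> set q} \<in> ?B - ?A"
    using path_block_in_LMC[OF EF q(1)] q(2) uv graph_path_ends[OF q(1)] by auto
  then have "?A \<noteq> ?B" by blast
  moreover have "?A face_of ?B"
    by (rule face_of_subset[OF face_of_LMC sub]) auto
  moreover have "convex ?B" by (rule face_of_imp_convex[OF face_of_LMC])
  \<comment> \<open>Two strict inclusions of faces, \<open>?A\<close> in \<open>?B\<close> and
    \<open>?B\<close> in \<open>?P\<close>, each lower the dimension, so \<open>?A\<close> has
    codimension at least two.\<close>
  ultimately have "aff_dim ?A < aff_dim ?B" by (intro face_of_aff_dim_lt)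
  moreover have "0 \<in> ?P - ?B" using zero_in_LMC[OF EF E conn] by simp
  then have "?B \<noteq> ?P" by blast
  then have "aff_dim ?B < aff_dim ?P" by (intro face_of_aff_dim_lt convex_LMC face_of_LMC)
  ultimately show False using facet by (simp add: facet_of_def)
qed

section \<open>Unit vectors in the span of the face, and the facet\<close>

lemma axis_in_span_face:
  fixes V :: "'v::finite set"
  assumes EF: "E \<union> F \<subseteq> nsets V 2" and st: "{s, t} \<in> E \<union> F"
    and "graph_path V E u v p" "{u, v} \<in> E \<union> F" "\<not> {s, t} \<subseteq> set p"
  shows "axis {u, v} 1 \<in> span {x \<in> LMC V E F. x $ {s, t} = 1}"
  using assms(3-)
\<comment> \<open>The ends stay arbitrary because the step passes to other pairs of nodes inside
  \<open>p\<close>.\<close>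
proof (induction "card (set p)" arbitrary: u v p rule: less_induct)
  case less
  let ?S = "span {x \<in> LMC V E F. x $ {s, t} = 1}"
  let ?I = "{g \<in> E \<union> F. g \<subseteq> set p}"
  note ends = graph_path_ends[OF less.prems(1)]
  have "s \<noteq> t" using EF st by (auto simp: nsets_def)
  have "u \<in> V" using less.prems(1) ends by (auto simp: graph_path_def)
  then have "graph_path V E u u [u]" by (simp add: graph_path_def)
  from path_block_in_LMC[OF EF this]
  have "char_vec {g \<in> E \<union> F. \<not> g \<subseteq> {u}} \<in> LMC V E F" by simp
  moreover have "{g \<in> E \<union> F. \<not> g \<subseteq> {u}} = E \<union> F"
    using EF by (auto simp: nsets_def subset_singleton_iff)
  ultimately have 1: "char_vec (E \<union> F) \<in> ?S"
    using st by (intro span_base) auto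
  \<comment> \<open>Since \<open>p\<close> misses \<open>s\<close> or \<open>t\<close>, contracting
    it leaves \<open>{s, t}\<close> cut, so the point stays in the face.\<close>
  have 2: "char_vec {g \<in> E \<union> F. \<not> g \<subseteq> set p} \<in> ?S"
    using path_block_in_LMC[OF EF less.prems(1)] st less.prems(3) by (intro span_base) auto
  have "char_vec (E \<union> F) - char_vec {g \<in> E \<union> F. \<not> g \<subseteq> set p} = char_vec ?I"
    by (auto simp: vec_eq_iff)
  with span_diff[OF 1 2] have I: "char_vec ?I \<in> ?S" by simp
  have "axis g 1 \<in> ?S" if g: "g \<in> ?I - {{u, v}}" for g
  proof -
    have "g \<in> nsets V 2" using g EF by blast
    then obtain a b where ab: "g = {a, b}" "a \<noteq> b"
      by (auto simp: nsets_def card_2_iff)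
    then obtain q where q: "graph_path V E a b q" "set q \<subseteq> set p"
      "{u, v} \<subseteq> set q \<Longrightarrow> {u, v} = {a, b}"
      using graph_subpath[OF less.prems(1), of a b] g by auto
    \<comment> \<open>As \<open>g\<close> is not \<open>{u, v}\<close>, the subpath misses
      \<open>u\<close> or \<open>v\<close>, both of which lie on \<open>p\<close>.\<close>
    have "set q \<subset> set p" using q g ab ends by auto
    then have "card (set q) < card (set p)" by (intro psubset_card_mono) auto
    then show ?thesis
      using less.hyps[OF _ q(1)] g ab q(2) less.prems(3) by auto
  qed
  then have "(\<Sum>g\<in>?I - {{u, v}}. axis g 1) \<in> ?S" by (rule span_sum)
  moreover have "char_vec ?I = axis {u, v} 1 + (\<Sum>g\<in>?I - {{u, v}}. axis g (1::real))"
    unfolding char_vec_eq_sum by (rule sum.remove) (use less.prems(2) ends in auto)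
  ultimately show ?case using I span_diff by fastforce
qed

lemma facet_of_LMC:
  fixes V :: "'v::finite set"
  assumes EF: "E \<union> F \<subseteq> nsets V 2" and E: "E \<subseteq> nsets V 2" and conn: "graph_connected V E"
    and st: "{s, t} \<in> E \<union> F"
    and nocut: "\<And>u v. {u, v} \<in> F - {{s, t}} \<Longrightarrow> \<not> (cut_node V E u v s \<and> cut_node V E u v t)"
  shows "{x \<in> LMC V E F. x $ {s, t} = 1} facet_of LMC V E F"
proof -
  let ?P = "LMC V E F"
  let ?A = "{x \<in> ?P. x $ {s, t} = 1}"
  have stV: "s \<in> V" "t \<in> V" "s \<noteq> t" using EF st by (auto simp: nsets_def)
  then have "graph_path V E s s [s]" by (simp add: graph_path_def)
  from path_block_in_LMC[OF EF this]
  have "char_vec {g \<in> E \<union> F. \<not> g \<subseteq> {s}} \<in> ?P" by simp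
  moreover have "{g \<in> E \<union> F. \<not> g \<subseteq> {s}} = E \<union> F"
    using EF by (auto simp: nsets_def subset_singleton_iff)
  ultimately have one: "char_vec (E \<union> F) \<in> ?A" using st by simp
  have axis_ne: "axis g 1 \<in> span ?A" if g: "g \<in> E \<union> F - {{s, t}}" for g
  proof -
    have "g \<in> nsets V 2" using g EF by blast
    then obtain u v where uv: "g = {u, v}" "u \<noteq> v" "u \<in> V" "v \<in> V"
      by (auto simp: nsets_def card_2_iff)
    \<comment> \<open>An edge of \<open>E\<close> is a path by itself and contains both
      \<open>s\<close> and \<open>t\<close> only if it equals \<open>{s, t}\<close>. For
      \<open>g \<in> F\<close>, a path avoiding one of them exists because they are not both
      cut-nodes.\<close>
    have "\<exists>p. graph_path V E u v p \<and> \<not> {s, t} \<subseteq> set p"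
    proof (cases "g \<in> E")
      case True
      then have "graph_path V E u v [u, v]" using uv by (simp add: graph_path_def)
      moreover have "\<not> {s, t} \<subseteq> set [u, v]" using g uv stV by auto
      ultimately show ?thesis by blast
    next
      case False
      then show ?thesis using nocut[of u v] g uv stV by (auto simp: cut_node_def)
    qed
    then show ?thesis using axis_in_span_face[OF EF st] g uv by blast
  qed
  \<comment> \<open>No path avoiding \<open>s\<close> or \<open>t\<close> joins them, so the unit
    vector of \<open>{s, t}\<close> is obtained by subtracting all others from the all-ones
    vector.\<close>
  have "char_vec (E \<union> F) = axis {s, t} 1 + (\<Sum>g\<in>E \<union> F - {{s, t}}. axis g (1::real))"
    unfolding char_vec_eq_sum by (rule sum.remove) (use st in auto)
  moreover have "(\<Sum>g\<in>E \<union> F - {{s, t}}. axis g 1) \<in> span ?A"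
    using axis_ne by (rule span_sum)
  ultimately have "axis {s, t} 1 \<in> span ?A"
    using span_diff[OF span_base[OF one]] by fastforce
  with axis_ne have axis: "axis g 1 \<in> span ?A" if "g \<in> E \<union> F" for g
    using that by blast
  have "?P \<subseteq> span ?A"
  proof (rule LMC_subset)
    show "convex (span ?A)" by (simp add: subspace_imp_convex)
    show "char_vec (lifted_multicut E F P) \<in> span ?A" for P
      unfolding char_vec_eq_sum
      by (intro span_sum axis) (simp add: lifted_multicut_def)
  qed
  \<comment> \<open>Passing from the linear to the affine span adds only the origin to
    \<open>?A\<close>, which raises the affine dimension by at most one.\<close>
  also have "span ?A = affine hull (insert 0 ?A)"
    by (simp add: affine_hull_span_0 hull_inc)
  finally have "aff_dim ?P \<le> aff_dim (affine hull (insert 0 ?A))"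
    by (rule aff_dim_subset)
  also have "\<dots> = aff_dim (insert 0 ?A)"
    by (rule aff_dim_affine_hull)
  also have "\<dots> \<le> aff_dim ?A + 1" by (simp add: aff_dim_insert)
  finally have "aff_dim ?P \<le> aff_dim ?A + 1" .
  moreover have "0 \<in> ?P - ?A" using zero_in_LMC[OF EF E conn] by simp
  then have "?A \<noteq> ?P" by blast
  then have "aff_dim ?A < aff_dim ?P" by (intro face_of_aff_dim_lt convex_LMC face_of_LMC)
  ultimately show ?thesis
    using one face_of_LMC unfolding facet_of_def by auto
qed

theorem theorem5p6:
  fixes V :: "'v::finite set" and E F :: "'v set set" and s t :: 'v
  assumes "E \<subseteq> nsets V 2"
    and "graph_connected V E"
    and "F \<subseteq> nsets V 2 - E"
    and "{s, t} \<in> E \<union> F"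
  shows "defines_facet (\<lambda>x. x $ {s, t}) 1 (LMC V E F) \<longleftrightarrow>
    \<not> (\<exists>u v. {u, v} \<in> F - {{s, t}} \<and> cut_node V E u v s \<and> cut_node V E u v t)"
proof -
  have EF: "E \<union> F \<subseteq> nsets V 2" using assms by blast
  have facet: "defines_facet (\<lambda>x. x $ {s, t}) 1 (LMC V E F) \<longleftrightarrow>
      {x \<in> LMC V E F. x $ {s, t} = 1} facet_of LMC V E F"
    by (auto simp: defines_facet_def LMC_le_1)
  show ?thesis
    unfolding facet
  proof
    assume "{x \<in> LMC V E F. x $ {s, t} = 1} facet_of LMC V E F"
    then show "\<not> (\<exists>u v. {u, v} \<in> F - {{s, t}} \<and> cut_node V E u v s \<and> cut_node V E u v t)"
      using not_facet_of_cut_nodes[OF EF assms(1,2,4)] by auto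
  next
    assume "\<not> (\<exists>u v. {u, v} \<in> F - {{s, t}} \<and> cut_node V E u v s \<and> cut_node V E u v t)"
    then show "{x \<in> LMC V E F. x $ {s, t} = 1} facet_of LMC V E F"
      by (intro facet_of_LMC[OF EF assms(1,2,4)]) blast
  qed
qed

end
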